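(* Let $K$ be a field of characteristic $0$ and let $(L,\cdot,\alpha)$ be a multiplicative left Hom-Leibniz algebra over $K$. Define a binary operation and a ternary operation on $L$ by $$[x,y] := x\cdot y - y\cdot x, \qquad \{x,y,z\} := -(x\cdot y)\cdot \alpha(z) \qquad (x,y,z\in L).$$ Then $(L,[\,,\,],\{\,,\,,\,\},\alpha)$ is a Hom-Lie-Yamaguti algebra.
   Context: All vector spaces and algebras are over a fixed field of characteristic $0$ (no finite-dimensionality is assumed). A Hom-algebra is a triple $(L,\cdot,\alpha)$ where $L$ is a vector space, $\cdot: L\times L\to L$ is a bilinear operation and $\alpha: L\to L$ is a linear map. It is multiplicative if $\alpha(x\cdot y)=\alpha(x)\cdot\alpha(y)$ for all $x,y\in L$. A left Hom-Leibniz algebra is a Hom-algebra $(L,\cdot,\alpha)$ satisfying, for all $x,y,z\in L$, $$\alpha(x)\cdot(y\cdot z) = (x\cdot y)\cdot\alpha(z) + \alpha(y)\cdot(x\cdot z).$$ A Hom-Lie-Yamaguti algebra is a quadruple $(L,[\,,\,],\{\,,\,,\,\},\alpha)$ where $L$ is a vector space, $[\,,\,]$ is a bilinear operation on $L$, $\{\,,\,,\,\}$ is a trilinear operation on $L$, and $\alpha: L\to L$ is a linear map such that, for all $u,v,w,x,y,z\in L$ (with $\circlearrowleft_{x,y,z}$ denoting the sum over cyclic permutations of $x,y,z$): (HLY1) $\alpha([x,y]) = [\alpha(x),\alpha(y)]$; (HLY2) $\alpha(\{x,y,z\}) = \{\alpha(x),\alpha(y),\alpha(z)\}$; (HLY3)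 $[x,y] = -[y,x]$; (HLY4) $\{x,y,z\} = -\{y,x,z\}$; (HLY5) $\circlearrowleft_{x,y,z}\big([[x,y],\alpha(z)] + \{x,y,z\}\big) = 0$; (HLY6) $\circlearrowleft_{x,y,z}\{[x,y],\alpha(z),\alpha(u)\} = 0$; (HLY7) $\{\alpha(x),\alpha(y),[u,v]\} = [\{x,y,u\},\alpha^2(v)] + [\alpha^2(u),\{x,y,v\}]$; (HLY8) $\{\alpha^2(x),\alpha^2(y),\{u,v,w\}\} = \{\{x,y,u\},\alpha^2(v),\alpha^2(w)\} + \{\alpha^2(u),\{x,y,v\},\alpha^2(w)\} + \{\alpha^2(u),\alpha^2(v),\{x,y,w\}\}$. *)

theory Defs
  imports Complex_Main
begin

definition bilinear_map :: "('k::field \<Rightarrow> 'v::ab_group_add \<Rightarrow> 'v) \<Rightarrow> ('v \<Rightarrow> 'v \<Rightarrow> 'v) \<Rightarrow> bool" where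
  "bilinear_map scale f \<longleftrightarrow>
     (\<forall>x. Vector_Spaces.linear scale scale (\<lambda>y. f x y)) \<and>
     (\<forall>y. Vector_Spaces.linear scale scale (\<lambda>x. f x y))"

definition trilinear_map :: "('k::field \<Rightarrow> 'v::ab_group_add \<Rightarrow> 'v) \<Rightarrow> ('v \<Rightarrow> 'v \<Rightarrow> 'v \<Rightarrow> 'v) \<Rightarrow> bool" where
  "trilinear_map scale f \<longleftrightarrow>
     (\<forall>x y. Vector_Spaces.linear scale scale (\<lambda>z. f x y z)) \<and>
     (\<forall>x z. Vector_Spaces.linear scale scale (\<lambda>y. f x y z)) \<and>
     (\<forall>y z. Vector_Spaces.linear scale scale (\<lambda>x. f x y z))"

definition cyclic_sum :: "('v \<Rightarrow> 'v \<Rightarrow> 'v \<Rightarrow> 'v::ab_group_add) \<Rightarrow> 'v \<Rightarrow> 'v \<Rightarrow> 'v \<Rightarrow> 'v" where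
  "cyclic_sum f x y z = f x y z + f y z x + f z x y"

locale hom_algebra = vector_space scale
  for scale :: "'k::field_char_0 \<Rightarrow> 'v::ab_group_add \<Rightarrow> 'v"
    and mult :: "'v \<Rightarrow> 'v \<Rightarrow> 'v"
    and \<alpha> :: "'v \<Rightarrow> 'v" +
  assumes bilinear_mult: "bilinear_map scale mult"
    and linear_twist: "Vector_Spaces.linear scale scale \<alpha>"

locale multiplicative_hom_algebra = hom_algebra +
  assumes twist_mult: "\<alpha> (mult x y) = mult (\<alpha> x) (\<alpha> y)"

locale left_hom_leibniz_algebra = hom_algebra +
  assumes left_hom_leibniz:
    "mult (\<alpha> x) (mult y z) = mult (mult x y) (\<alpha> z) + mult (\<alpha> y) (mult x z)"

locale hom_lie_yamaguti_algebra = vector_space scale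
  for scale :: "'k::field_char_0 \<Rightarrow> 'v::ab_group_add \<Rightarrow> 'v"
    and br :: "'v \<Rightarrow> 'v \<Rightarrow> 'v"
    and tr :: "'v \<Rightarrow> 'v \<Rightarrow> 'v \<Rightarrow> 'v"
    and \<alpha> :: "'v \<Rightarrow> 'v" +
  assumes bilinear_br: "bilinear_map scale br"
    and trilinear_tr: "trilinear_map scale tr"
    and linear_twist: "Vector_Spaces.linear scale scale \<alpha>"
    and HLY1: "\<alpha> (br x y) = br (\<alpha> x) (\<alpha> y)"
    and HLY2: "\<alpha> (tr x y z) = tr (\<alpha> x) (\<alpha> y) (\<alpha> z)"
    and HLY3: "br x y = - br y x"
    and HLY4: "tr x y z = - tr y x z"
    and HLY5: "cyclic_sum (\<lambda>x y z. br (br x y) (\<alpha> z) + tr x y z) x y z = 0"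
    and HLY6: "cyclic_sum (\<lambda>x y z. tr (br x y) (\<alpha> z) (\<alpha> u)) x y z = 0"
    and HLY7: "tr (\<alpha> x) (\<alpha> y) (br u v) =
      br (tr x y u) ((\<alpha> ^^ 2) v) + br ((\<alpha> ^^ 2) u) (tr x y v)"
    and HLY8: "tr ((\<alpha> ^^ 2) x) ((\<alpha> ^^ 2) y) (tr u v w) =
      tr (tr x y u) ((\<alpha> ^^ 2) v) ((\<alpha> ^^ 2) w)
      + tr ((\<alpha> ^^ 2) u) (tr x y v) ((\<alpha> ^^ 2) w)
      + tr ((\<alpha> ^^ 2) u) ((\<alpha> ^^ 2) v) (tr x y w)"

end

theory Submission
  imports Defs
begin

text \<open>The left Hom-Leibniz identity says that left multiplications are twisted derivations; it also
  makes \<open>(x y) \<alpha>(z) = \<alpha>(x) (y z) - \<alpha>(y) (x z)\<close> skew-symmetric in \<open>x, y\<close>. The derivation axioms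
  HLY7 and HLY8 come from applying the identity to left multiplication by \<open>x y\<close>, and HLY5 from
  expanding \<open>(x y) \<alpha>(z)\<close>. For HLY6, the cyclic sum of \<open>((x y) \<alpha>(z)) \<alpha>\<^sup>2(u)\<close> vanishes:
  expanding the inner factor gives \<open>(\<alpha>(x) (y z)) \<alpha>\<^sup>2(u) - (\<alpha>(y) (x z)) \<alpha>\<^sup>2(u)\<close>, and
  skew-symmetry turns these two terms into the negatives of the other two summands.\<close>

context hom_algebra
begin

lemma
  shows mult_add_left: "mult (x + y) z = mult x z + mult y z"
    and mult_add_right: "mult x (y + z) = mult x y + mult x z"
    and mult_diff_left: "mult (x - y) z = mult x z - mult y z"
    and mult_diff_right: "mult x (y - z) = mult x y - mult x z"
    and mult_minus_left: "mult (- x) z = - mult x z"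
    and mult_minus_right: "mult x (- z) = - mult x z"
    and mult_scale_left: "mult (scale c x) y = scale c (mult x y)"
    and mult_scale_right: "mult x (scale c y) = scale c (mult x y)"
proof -
  have l: "module_hom scale scale (\<lambda>x. mult x z)" and r: "module_hom scale scale (mult z)" for z
    using bilinear_mult by (simp_all add: bilinear_map_def Vector_Spaces.linear_def)
  show "mult (x + y) z = mult x z + mult y z" "mult x (y + z) = mult x y + mult x z"
    "mult (x - y) z = mult x z - mult y z" "mult x (y - z) = mult x y - mult x z"
    "mult (- x) z = - mult x z" "mult x (- z) = - mult x z"
    "mult (scale c x) y = scale c (mult x y)" "mult x (scale c y) = scale c (mult x y)"
    by (fact module_hom.add[OF l] module_hom.add[OF r] module_hom.diff[OF l] module_hom.diff[OF r]
        module_hom.neg[OF l] module_hom.neg[OF r] module_hom.scale[OF l] module_hom.scale[OF r])+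
qed

lemma
  shows twist_add: "\<alpha> (x + y) = \<alpha> x + \<alpha> y"
    and twist_diff: "\<alpha> (x - y) = \<alpha> x - \<alpha> y"
    and twist_minus: "\<alpha> (- x) = - \<alpha> x"
    and twist_scale: "\<alpha> (scale c x) = scale c (\<alpha> x)"
proof -
  have "module_hom scale scale \<alpha>"
    using linear_twist by (simp add: Vector_Spaces.linear_def)
  then show "\<alpha> (x + y) = \<alpha> x + \<alpha> y" "\<alpha> (x - y) = \<alpha> x - \<alpha> y" "\<alpha> (- x) = - \<alpha> x"
    "\<alpha> (scale c x) = scale c (\<alpha> x)"
    by (simp_all add: module_hom.add module_hom.diff module_hom.neg module_hom.scale)
qed

lemmas mult_linear_simps =
  mult_add_left mult_add_right mult_diff_left mult_diff_right mult_minus_left mult_minus_right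
lemmas twist_linear_simps = twist_add twist_diff twist_minus

lemma linearI:
  assumes "\<And>x y. f (x + y) = f x + f y" "\<And>c x. f (scale c x) = scale c (f x)"
  shows "Vector_Spaces.linear scale scale f"
  using assms vector_space_axioms module_axioms
  by (simp add: Vector_Spaces.linear_def module_hom_def module_hom_axioms_def)

lemma bilinear_commutator: "bilinear_map scale (\<lambda>x y. mult x y - mult y x)"
  unfolding bilinear_map_def
  by (auto intro!: linearI
      simp: mult_linear_simps mult_scale_left mult_scale_right scale_right_diff_distrib)

lemma trilinear_left_product: "trilinear_map scale (\<lambda>x y z. - mult (mult x y) (\<alpha> z))"
  unfolding trilinear_map_def
  by (auto intro!: linearI
      simp: mult_linear_simps mult_scale_left mult_scale_right twist_add twist_scale)

end

context left_hom_leibniz_algebra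
begin

text \<open>Oriented as a rewrite rule, the identity trades products nested on the left for products
  of the form \<open>mult (\<alpha> a) (mult b c)\<close>.\<close>

lemma mult_mult_twist:
  "mult (mult x y) (\<alpha> z) = mult (\<alpha> x) (mult y z) - mult (\<alpha> y) (mult x z)"
  using left_hom_leibniz[of x y z] by simp

lemma mult_mult_twist_skew: "mult (mult x y) (\<alpha> z) = - mult (mult y x) (\<alpha> z)"
  by (simp add: mult_mult_twist)

text \<open>Once all products are nested on the right, a summand reduces to \<alpha>(x)(yz) -
  \<alpha>(z)(xy) + \<alpha>(z)(yx) - \<alpha>(y)(xz). In each of these two differences, both terms
  run through the same cyclic orbit and cancel.\<close>

lemma cyclic_sum_commutator_left_product:
  "cyclic_sum (\<lambda>x y z.
     (mult (mult x y - mult y x) (\<alpha> z) - mult (\<alpha> z) (mult x y - mult y x))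
       + - mult (mult x y) (\<alpha> z)) x y z = 0"
  by (simp add: cyclic_sum_def mult_linear_simps mult_mult_twist)

end

locale multiplicative_left_hom_leibniz_algebra =
  left_hom_leibniz_algebra + multiplicative_hom_algebra
begin

lemma cyclic_sum_mult_mult_mult:
  "mult (mult (mult x y) (\<alpha> z)) (\<alpha> (\<alpha> u))
   + mult (mult (mult y z) (\<alpha> x)) (\<alpha> (\<alpha> u))
   + mult (mult (mult z x) (\<alpha> y)) (\<alpha> (\<alpha> u)) = 0"
proof -
  let ?m = "\<lambda>x y z. mult (mult (mult x y) (\<alpha> z)) (\<alpha> (\<alpha> u))"
  have skew: "?m a b c = - ?m b a c" for a b c
    using mult_mult_twist_skew[of a b c] by (simp add: mult_minus_left)
  have expand: "?m a b c = ?m a c b - ?m b c a" for a b c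
  proof -
    \<comment> \<open>Here skew-symmetry acts one level further out: the exchanged factors are
      \<open>\<alpha> p\<close> and the whole product \<open>mult q r\<close>, with
      \<open>\<alpha> u\<close> as third argument.\<close>
    have swap: "mult (mult (\<alpha> p) (mult q r)) (\<alpha> (\<alpha> u)) = - ?m q r p" for p q r
      by (rule mult_mult_twist_skew)
    have "?m a b c =
      mult (mult (\<alpha> a) (mult b c)) (\<alpha> (\<alpha> u)) - mult (mult (\<alpha> b) (mult a c)) (\<alpha> (\<alpha> u))"
      by (subst mult_mult_twist[of a b c]) (rule mult_diff_left)
    then show ?thesis
      unfolding swap by simp
  qed
  show ?thesis
    using expand[of x y z] skew[of x z y] by simp
qed

sublocale hom_lie_yamaguti_algebra scale
  "\<lambda>x y. mult x y - mult y x" "\<lambda>x y z. - mult (mult x y) (\<alpha> z)" \<alpha>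
proof unfold_locales
  fix x y z u v w
  show "cyclic_sum (\<lambda>x y z. - mult (mult (mult x y - mult y x) (\<alpha> z)) (\<alpha> (\<alpha> u))) x y z = 0"
  proof -
    \<comment> \<open>The two terms of the commutator contribute equally by skew-symmetry, so the
      HLY6 sum is minus twice the vanishing cyclic sum.\<close>
    have double: "- mult (mult (mult a b - mult b a) (\<alpha> c)) (\<alpha> (\<alpha> u))
        = - (mult (mult (mult a b) (\<alpha> c)) (\<alpha> (\<alpha> u)) + mult (mult (mult a b) (\<alpha> c)) (\<alpha> (\<alpha> u)))"
      for a b c
      using mult_mult_twist_skew[of b a c] by (simp add: mult_linear_simps)
    have "- (p + p) + - (q + q) + - (r + r) = - (p + q + r) - (p + q + r)" for p q r :: 'b
      by (simp add: algebra_simps)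
    then show ?thesis
      unfolding cyclic_sum_def double by (simp only: cyclic_sum_mult_mult_mult) simp
  qed
  \<comment> \<open>HLY7: by multiplicativity the left side involves left multiplication by
    \<open>\<alpha> (mult x y)\<close>. The two instances expand it on \<alpha>(u)\<alpha>(v) and on
    \<alpha>(v)\<alpha>(u); their difference is the claim.\<close>
  show "- mult (mult (\<alpha> x) (\<alpha> y)) (\<alpha> (mult u v - mult v u)) =
    (mult (- mult (mult x y) (\<alpha> u)) ((\<alpha> ^^ 2) v) - mult ((\<alpha> ^^ 2) v) (- mult (mult x y) (\<alpha> u)))
    + (mult ((\<alpha> ^^ 2) u) (- mult (mult x y) (\<alpha> v)) - mult (- mult (mult x y) (\<alpha> v)) ((\<alpha> ^^ 2) u))"
    using left_hom_leibniz[of "mult x y" "\<alpha> u" "\<alpha> v"] left_hom_leibniz[of "mult x y" "\<alpha> v" "\<alpha> u"]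
    by (simp add: numeral_2_eq_2 twist_mult twist_linear_simps mult_linear_simps)
  \<comment> \<open>HLY8: the derivation rule is used twice. The second instance splits off the term
    acting on \<open>w\<close>; the first expands the remaining factor
    \<open>mult (\<alpha> (mult x y)) (\<alpha> (mult u v))\<close> into the terms acting on
    \<open>u\<close> and \<open>v\<close>.\<close>
  show "- mult (mult ((\<alpha> ^^ 2) x) ((\<alpha> ^^ 2) y)) (\<alpha> (- mult (mult u v) (\<alpha> w))) =
    - mult (mult (- mult (mult x y) (\<alpha> u)) ((\<alpha> ^^ 2) v)) (\<alpha> ((\<alpha> ^^ 2) w))
    + - mult (mult ((\<alpha> ^^ 2) u) (- mult (mult x y) (\<alpha> v))) (\<alpha> ((\<alpha> ^^ 2) w))
    + - mult (mult ((\<alpha> ^^ 2) u) ((\<alpha> ^^ 2) v)) (\<alpha> (- mult (mult x y) (\<alpha> w)))"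
    using left_hom_leibniz[of "mult x y" "\<alpha> u" "\<alpha> v"]
      left_hom_leibniz[of "\<alpha> (mult x y)" "\<alpha> (mult u v)" "\<alpha> (\<alpha> w)"]
    by (simp add: numeral_2_eq_2 twist_mult twist_linear_simps mult_linear_simps)
  show "- mult (mult x y) (\<alpha> z) = - (- mult (mult y x) (\<alpha> z))"
    using mult_mult_twist_skew[of x y z] by simp
qed (rule bilinear_commutator trilinear_left_product cyclic_sum_commutator_left_product
    | simp add: twist_linear_simps twist_scale twist_mult)+

end

theorem mainTheorem1:
  fixes scale :: "'k::field_char_0 \<Rightarrow> 'v::ab_group_add \<Rightarrow> 'v"
    and mult :: "'v \<Rightarrow> 'v \<Rightarrow> 'v"
    and \<alpha> :: "'v \<Rightarrow> 'v"
  assumes "left_hom_leibniz_algebra scale mult \<alpha>"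
    and "multiplicative_hom_algebra scale mult \<alpha>"
  shows "hom_lie_yamaguti_algebra scale
           (\<lambda>x y. mult x y - mult y x)
           (\<lambda>x y z. - mult (mult x y) (\<alpha> z))
           \<alpha>"
proof -
  interpret left_hom_leibniz_algebra scale mult \<alpha> by fact
  interpret multiplicative_hom_algebra scale mult \<alpha> by fact
  interpret multiplicative_left_hom_leibniz_algebra scale mult \<alpha> by unfold_locales
  show ?thesis by (rule hom_lie_yamaguti_algebra_axioms)
qed

end
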